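(* Let $\phi=\tilde p/p$ be a rational inner function on $\mathbb{D}^2$ with $\deg\phi=(m,n)$, and assume $N_{\mathbb{T}^2}(\tilde p,p)=2mn$ (with $mn\ge1$). Then at least one of $\frac{\partial\phi}{\partial z_1}$, $\frac{\partial\phi}{\partial z_2}$ is not in $H^2(\mathbb{D}^2)$.
   Context: $\phi=\tilde p/p$ where $p\in\mathbb{C}[z_1,z_2]$ has bidegree $(m,n)$, no zeros in $\mathbb{D}^2$, is atoral (no common factor with $\tilde p$), and $\tilde p(z)=z_1^mz_2^n\overline{p(1/\bar z_1,1/\bar z_2)}$. $N_{\mathbb{T}^2}(\tilde p,p)$ is the sum, over common zeros $\lambda\in\mathbb{T}^2$ of $p$ and $\tilde p$, of the intersection multiplicities $N_\lambda(p,\tilde p)$ of the algebraic curves $\{p=0\}$ and $\{\tilde p=0\}$; by Bézout it is at most $2mn$. $H^2(\mathbb{D}^2)$: holomorphic $f$ with $\sup_{0<r<1}\frac1{4\pi^2}\int_{\mathbb{T}^2}|f(r\zeta)|^2|d\zeta|<\infty$. *)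

theory Defs
  imports "HOL-Analysis.Analysis" "HOL-Computational_Algebra.Polynomial"
begin

text \<open>Bivariate complex polynomials are represented as polynomials in z2 whose
  coefficients are polynomials in z1: type complex poly poly.\<close>

type_synonym bipoly = "complex poly poly"

definition eval2 :: "bipoly \<Rightarrow> complex \<Rightarrow> complex \<Rightarrow> complex" where
  "eval2 p z1 z2 = poly (map_poly (\<lambda>c. poly c z1) p) z2"

definition deg1 :: "bipoly \<Rightarrow> nat" where
  "deg1 p = (MAX k\<in>{..degree p}. degree (coeff p k))"

definition deg2 :: "bipoly \<Rightarrow> nat" where
  "deg2 p = degree p"

definition const2 :: "complex \<Rightarrow> bipoly" where
  "const2 c = [:[:c:]:]"

text \<open>Polynomials f lying in the ideal generated by p and q in the local ring
  O_lambda of rational functions regular at lambda.\<close>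
definition in_local_ideal :: "complex \<times> complex \<Rightarrow> bipoly \<Rightarrow> bipoly \<Rightarrow> bipoly \<Rightarrow> bool" where
  "in_local_ideal lam p q f \<longleftrightarrow>
     (\<exists>h a b. eval2 h (fst lam) (snd lam) \<noteq> 0 \<and> h * f = a * p + b * q)"

text \<open>Intersection multiplicity N_lambda(p,q) = dim_C O_lambda / (p,q),
  computed as the supremum of the sizes of families of polynomials that are
  linearly independent modulo the local ideal.\<close>
definition int_mult :: "complex \<times> complex \<Rightarrow> bipoly \<Rightarrow> bipoly \<Rightarrow> enat" where
  "int_mult lam p q = (SUP k \<in> {k. \<exists>fs :: nat \<Rightarrow> bipoly.
       \<forall>c :: nat \<Rightarrow> complex.
         in_local_ideal lam p q (\<Sum>i<k. const2 (c i) * fs i) \<longrightarrow> (\<forall>i<k. c i = 0)}. enat k)"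

definition torus :: "(complex \<times> complex) set" where
  "torus = {(z1, z2). cmod z1 = 1 \<and> cmod z2 = 1}"

definition N_torus :: "bipoly \<Rightarrow> bipoly \<Rightarrow> enat" where
  "N_torus q p = (\<Sum>lam \<in> {lam \<in> torus. eval2 p (fst lam) (snd lam) = 0
                                    \<and> eval2 q (fst lam) (snd lam) = 0}. int_mult lam p q)"

text \<open>Hardy space H^2 of the bidisk. Holomorphy in two variables is rendered as
  continuity plus separate holomorphy (equivalent by Osgood's lemma).\<close>
definition in_H2 :: "(complex \<Rightarrow> complex \<Rightarrow> complex) \<Rightarrow> bool" where
  "in_H2 f \<longleftrightarrow>
     continuous_on (ball 0 1 \<times> ball 0 1) (\<lambda>(z1, z2). f z1 z2) \<and>
     (\<forall>z2\<in>ball 0 1. (\<lambda>z1. f z1 z2) holomorphic_on ball 0 1) \<and>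
     (\<forall>z1\<in>ball 0 1. (\<lambda>z2. f z1 z2) holomorphic_on ball 0 1) \<and>
     (SUP r \<in> {0<..<1::real}. ennreal (1 / (4 * pi\<^sup>2)) *
        (\<integral>\<^sup>+ x. indicator ({0..2*pi} \<times> {0..2*pi}) x *
            ennreal ((cmod (f (of_real r * cis (fst x)) (of_real r * cis (snd x))))\<^sup>2) \<partial>lborel))
       < \<infinity>"

end

theory Submission
  imports Defs "HOL-Complex_Analysis.Complex_Analysis"
    "HOL-Computational_Algebra.Fundamental_Theorem_Algebra"
begin

text \<open>
  A single common zero \<open>(\<mu>1, \<mu>2)\<close> on the torus suffices; the multiplicity hypothesis provides one.
  Restrict \<open>\<phi>\<close> to the discs \<open>f\<^sub>s(t) = \<phi>(\<mu>1 t, \<mu>2 e\<^sup>i\<^sup>s t)\<close>. Since \<open>p\<close> has no zeros in the bidisc, its lowest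
  homogeneous part \<open>Q\<close> at the singularity satisfies \<open>Q(1, 1) \<noteq> 0\<close>, and a blow-up together with Hurwitz's
  theorem yields for every small \<open>s > 0\<close> a zero of \<open>p\<close> at \<open>(\<mu>1 \<beta>, \<mu>2 e\<^sup>i\<^sup>s \<beta>)\<close> with \<open>\<beta> - 1 = O(s)\<close>.
  By reflection \<open>f\<^sub>s\<close> has a zero at distance \<open>O(s)\<close> from the unit circle, while \<open>f\<^sub>s\<close> is unimodular on
  the circle; hence the squared \<open>H\<^sup>2\<close> norm of \<open>f\<^sub>s'\<close> is at least of order \<open>1/s\<close>. If both partial derivatives were in
  \<open>H\<^sup>2\<close>, these norms would be integrable in \<open>s\<close>, but \<open>1/s\<close> is not.
\<close>

section \<open>Integration\<close>

text \<open>Removing a multiple of \<open>T\<close> brings \<open>c\<close> to some \<open>d\<close>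
  in \<open>[0, T)\<close>; the part of the window \<open>[d, T + d)\<close> beyond \<open>T\<close>
  is then moved back by one period. Half-open windows fit together exactly, and the endpoint
  \<open>T\<close> is a null set.\<close>

lemma nn_integral_periodic_shift:
  fixes g :: "real \<Rightarrow> ennreal" and T c :: real
  assumes [measurable]: "g \<in> borel_measurable borel"
    and T: "T > 0" and per: "\<And>x. g (x + T) = g x"
  shows "(\<integral>\<^sup>+x. indicator {0..T} x * g (x + c) \<partial>lborel) = (\<integral>\<^sup>+x. indicator {0..T} x * g x \<partial>lborel)"
proof -
  have per_int: "g (x + of_int k * T) = g x" for x and k :: int
  proof (induction k rule: int_induct[of _ 0])
    case (step1 i)
    then show ?case using per[of "x + of_int i * T"] by (simp add: algebra_simps)
  next
    case (step2 i)
    then show ?case using per[of "x + of_int (i - 1) * T"] by (simp add: algebra_simps)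
  qed simp
  define d where "d = c - of_int \<lfloor>c / T\<rfloor> * T"
  have "of_int \<lfloor>c / T\<rfloor> * T \<le> c" "c < (of_int \<lfloor>c / T\<rfloor> + 1) * T"
    using T floor_correct[of "c / T"] by (auto simp only: pos_le_divide_eq pos_divide_less_eq of_int_add of_int_1)
  then have d: "0 \<le> d" "d < T"
    by (simp_all add: d_def algebra_simps)
  have gd: "g (x + c) = g (x + d)" for x
    using per_int[of "x + d" "\<lfloor>c / T\<rfloor>"] by (simp add: d_def algebra_simps)
  have shift: "(\<integral>\<^sup>+x. indicator {a..<b} x * g (x + e) \<partial>lborel) = (\<integral>\<^sup>+x. indicator {a + e..<b + e} x * g x \<partial>lborel)"
    for a b e :: real
    by (subst nn_integral_real_affine[where c = 1 and t = e])
       (auto intro!: nn_integral_cong simp: indicator_def add.commute)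
  have split: "(\<integral>\<^sup>+x. indicator {a..<b} x * g x \<partial>lborel) + (\<integral>\<^sup>+x. indicator {b..<e} x * g x \<partial>lborel)
      = (\<integral>\<^sup>+x. indicator {a..<e} x * g x \<partial>lborel)" if "a \<le> b" "b \<le> e" for a b e :: real
    using that by (subst nn_integral_add[symmetric]) (auto intro!: nn_integral_cong simp: indicator_def)
  have closed: "(\<integral>\<^sup>+x. indicator {0..T} x * f x \<partial>lborel) = (\<integral>\<^sup>+x. indicator {0..<T} x * f x \<partial>lborel)"
    for f :: "real \<Rightarrow> ennreal"
    by (rule nn_integral_cong_AE) (use AE_lborel_singleton[of T] in eventually_elim, auto simp: indicator_def)
  have "(\<integral>\<^sup>+x. indicator {0..T} x * g (x + c) \<partial>lborel) = (\<integral>\<^sup>+x. indicator {d..<T + d} x * g x \<partial>lborel)"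
    unfolding closed gd by (subst shift) simp
  also have "\<dots> = (\<integral>\<^sup>+x. indicator {d..<T} x * g x \<partial>lborel) + (\<integral>\<^sup>+x. indicator {0 + T..<d + T} x * g x \<partial>lborel)"
    using split[of d T "T + d"] d by (simp add: add.commute)
  also have "(\<integral>\<^sup>+x. indicator {0 + T..<d + T} x * g x \<partial>lborel) = (\<integral>\<^sup>+x. indicator {0..<d} x * g x \<partial>lborel)"
    using shift[of 0 d T] by (simp only: per)
  also have "(\<integral>\<^sup>+x. indicator {d..<T} x * g x \<partial>lborel) + \<dots> = (\<integral>\<^sup>+x. indicator {0..<T} x * g x \<partial>lborel)"
    using split[of 0 d T] d by (simp add: add.commute)
  finally show ?thesis unfolding closed .
qed

text \<open>After exchanging the integrals, the substitution is a translation in \<open>s\<close>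
  for fixed \<open>x\<close>, followed by one in \<open>x\<close>; both preserve the measure of the
  torus. This turns a torus integral into an integral over \<open>s\<close> of integrals over
  diagonal circles.\<close>

lemma nn_integral_periodic_shear:
  fixes h :: "real \<times> real \<Rightarrow> ennreal" and T a b :: real
  assumes [measurable]: "h \<in> borel_measurable borel"
    and T: "T > 0" and per: "\<And>x y. h (x + T, y) = h (x, y)" "\<And>x y. h (x, y + T) = h (x, y)"
  shows "(\<integral>\<^sup>+s. indicator {0..T} s * (\<integral>\<^sup>+x. indicator {0..T} x * h (x + a, x + b + s) \<partial>lborel) \<partial>lborel)
    = (\<integral>\<^sup>+z. indicator ({0..T} \<times> {0..T}) z * h z \<partial>lborel)"
proof -
  have [measurable]: "h \<in> borel_measurable (borel \<Otimes>\<^sub>M borel)"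
    by (simp add: borel_prod)
  have "(\<integral>\<^sup>+s. indicator {0..T} s * (\<integral>\<^sup>+x. indicator {0..T} x * h (x + a, x + b + s) \<partial>lborel) \<partial>lborel)
      = (\<integral>\<^sup>+s. (\<integral>\<^sup>+x. indicator {0..T} s * (indicator {0..T} x * h (x + a, x + b + s)) \<partial>lborel) \<partial>lborel)"
    by (intro nn_integral_cong nn_integral_cmult[symmetric]) measurable
  also have "\<dots> = (\<integral>\<^sup>+x. (\<integral>\<^sup>+s. indicator {0..T} s * (indicator {0..T} x * h (x + a, x + b + s)) \<partial>lborel) \<partial>lborel)"
    by (rule lborel_pair.Fubini') measurable
  also have "\<dots> = (\<integral>\<^sup>+x. indicator {0..T} x * (\<integral>\<^sup>+s. indicator {0..T} s * h (x + a, s + (x + b)) \<partial>lborel) \<partial>lborel)"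
    by (intro nn_integral_cong, subst nn_integral_cmult[symmetric], measurable)
       (auto intro!: nn_integral_cong simp: ac_simps)
  also have "\<dots> = (\<integral>\<^sup>+x. indicator {0..T} x * (\<integral>\<^sup>+s. indicator {0..T} s * h (x + a, s) \<partial>lborel) \<partial>lborel)"
    by (intro nn_integral_cong arg_cong2[where f = "(*)"] refl
        nn_integral_periodic_shift[where g = "\<lambda>s. h (_ + a, s)"] T per) measurable
  also have "\<dots> = (\<integral>\<^sup>+x. indicator {0..T} x * (\<integral>\<^sup>+s. indicator {0..T} s * h (x, s) \<partial>lborel) \<partial>lborel)"
    by (rule nn_integral_periodic_shift[where g = "\<lambda>x. \<integral>\<^sup>+s. indicator {0..T} s * h (x, s) \<partial>lborel"])
       (use T per in simp_all)
  also have "\<dots> = (\<integral>\<^sup>+x. (\<integral>\<^sup>+s. indicator ({0..T} \<times> {0..T}) (x, s) * h (x, s) \<partial>lborel) \<partial>lborel)"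
    by (intro nn_integral_cong, subst nn_integral_cmult[symmetric], measurable)
       (auto intro!: nn_integral_cong simp: indicator_def)
  also have "\<dots> = (\<integral>\<^sup>+z. indicator ({0..T} \<times> {0..T}) z * h z \<partial>(lborel \<Otimes>\<^sub>M lborel))"
    by (rule lborel.nn_integral_fst) measurable
  finally show ?thesis by (simp add: lborel_prod)
qed

lemma nn_integral_inverse_at_0:
  assumes "0 < \<delta>" "0 < (c::real)"
  shows "(\<integral>\<^sup>+s. indicator {0<..<\<delta>} s * ennreal (c / s) \<partial>lborel) = \<infinity>"
proof (rule ccontr)
  assume "\<not> ?thesis"
  then obtain B where B: "B \<ge> 0" "(\<integral>\<^sup>+s. indicator {0<..<\<delta>} s * ennreal (c / s) \<partial>lborel) = ennreal B"
    by (cases "\<integral>\<^sup>+s. indicator {0<..<\<delta>} s * ennreal (c / s) \<partial>lborel") auto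
  define d where "d = \<delta> / 2"
  \<comment> \<open>With this \<open>e\<close> the antiderivative \<open>c * ln s\<close> increases
    by exactly \<open>B + 1\<close> from \<open>e\<close> to \<open>d\<close>.\<close>
  define e where "e = d * exp (- (B + 1) / c)"
  have e: "0 < e" "e \<le> d" "d < \<delta>" "0 < d"
    using assms B by (auto simp: e_def d_def divide_nonpos_pos mult_le_cancel_left1)
  have "((\<lambda>s. c * ln s) has_real_derivative c / x) (at x)" if "e \<le> x" "x \<le> d" for x
    using that e by (auto intro!: derivative_eq_intros)
  then have "(\<integral>\<^sup>+s. ennreal (c / s) * indicator {e..d} s \<partial>lborel) = ennreal (c * ln d - c * ln e)"
    using e assms by (intro nn_integral_FTC_Icc[where F = "\<lambda>s. c * ln s"]) (auto simp: has_field_derivative_at_within)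
  also have "c * ln d - c * ln e = B + 1"
    using e assms by (simp add: e_def ln_mult field_simps)
  finally have "ennreal (B + 1) = (\<integral>\<^sup>+s. ennreal (c / s) * indicator {e..d} s \<partial>lborel)" ..
  also have "\<dots> \<le> (\<integral>\<^sup>+s. indicator {0<..<\<delta>} s * ennreal (c / s) \<partial>lborel)"
    using e by (intro nn_integral_mono) (auto simp: indicator_def)
  finally show False
    using B by simp
qed

text \<open>Applying Cauchy's formula to the square avoids the Cauchy--Schwarz inequality.\<close>

lemma norm_square_le_circle_mean:
  fixes F :: "complex \<Rightarrow> complex"
  assumes holF: "F holomorphic_on ball 0 1" and r: "cmod z < r" "r < 1"
  shows "2 * pi * (r - cmod z) * (cmod (F z))\<^sup>2 \<le> integral {0..2*pi} (\<lambda>x. (cmod (F (of_real r * cis x)))\<^sup>2)"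
proof -
  have r0: "r > 0" using r(1) norm_ge_zero[of z] by linarith
  have sub: "of_real r * cis x \<in> ball 0 1" for x
    using r0 r by (simp add: norm_mult)
  have contF: "continuous_on UNIV (\<lambda>x. F (of_real r * cis x))"
    by (rule continuous_on_compose2[OF holomorphic_on_imp_continuous_on[OF holF]])
       (use sub in \<open>auto intro!: continuous_intros\<close>)
  have ne: "of_real r * cis x \<noteq> z" for x
    using r0 r by (metis abs_of_pos mult.right_neutral norm_cis norm_mult norm_of_real order.strict_iff_not order_refl)
  define G where "G = (\<lambda>x. (F (of_real r * cis x))\<^sup>2 / (of_real r * cis x - z) * of_real r * \<i> * cis x)"
  have "((\<lambda>u. (F u)\<^sup>2 / (u - z)) has_contour_integral (2 * of_real pi * \<i> * (F z)\<^sup>2)) (circlepath 0 r)"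
    by (rule Cauchy_integral_circlepath_simple)
       (use r in \<open>auto intro!: holomorphic_intros holomorphic_on_subset[OF holF]\<close>)
  then have "contour_integral (part_circlepath 0 r 0 (2*pi)) (\<lambda>u. (F u)\<^sup>2 / (u - z)) = 2 * of_real pi * \<i> * (F z)\<^sup>2"
    by (simp add: circlepath_def contour_integral_unique)
  then have "integral {0..2*pi} G = 2 * of_real pi * \<i> * (F z)\<^sup>2"
    by (subst (asm) contour_integral_part_circlepath_eq) (simp_all add: G_def mult_ac)
  then have "2 * pi * (cmod (F z))\<^sup>2 = cmod (integral {0..2*pi} G)"
    by (simp add: norm_mult norm_power)
  also have "\<dots> \<le> integral {0..2*pi} (\<lambda>x. (cmod (F (of_real r * cis x)))\<^sup>2 / (r - cmod z))"
  proof (rule integral_norm_bound_integral)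
    show "G integrable_on {0..2*pi}" unfolding G_def
      by (rule integrable_continuous_interval)
         (use ne in \<open>auto intro!: continuous_intros continuous_on_subset[OF contF]\<close>)
    show "(\<lambda>x. (cmod (F (of_real r * cis x)))\<^sup>2 / (r - cmod z)) integrable_on {0..2*pi}"
      by (rule integrable_continuous_interval)
         (use r in \<open>auto intro!: continuous_intros continuous_on_subset[OF contF]\<close>)
    fix x assume "x \<in> {0..2*pi}"
    \<comment> \<open>The circle keeps distance at least \<open>r - cmod z\<close> from
      \<open>z\<close>; the factor \<open>r < 1\<close> coming from the parametrisation is bounded
      by 1.\<close>
    have "r - cmod z \<le> cmod (of_real r * cis x - z)"
      using norm_triangle_ineq2[of "of_real r * cis x" z] r0 by (simp add: norm_mult)
    then have "(cmod (F (of_real r * cis x)))\<^sup>2 * r / cmod (of_real r * cis x - z)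
        \<le> (cmod (F (of_real r * cis x)))\<^sup>2 * 1 / (r - cmod z)"
      using r r0 by (intro frac_le mult_left_mono) auto
    then show "cmod (G x) \<le> (cmod (F (of_real r * cis x)))\<^sup>2 / (r - cmod z)"
      using r0 by (simp add: G_def norm_mult norm_divide norm_power)
  qed
  finally show ?thesis
    using r by (simp add: field_simps)
qed

section \<open>Growth of a holomorphic function along a radius\<close>

lemma holomorphic_on_derivative:
  assumes "open S" "\<And>z. z \<in> S \<Longrightarrow> (f has_field_derivative F z) (at z)"
  shows "F holomorphic_on S"
proof -
  have "f holomorphic_on S"
    using assms(2) by (meson field_differentiable_at_within field_differentiable_def holomorphic_on_def)
  then have "deriv f holomorphic_on S"
    using assms(1) by (rule holomorphic_deriv)
  then show ?thesis
    by (rule holomorphic_transform) (use assms(2) in \<open>auto intro: DERIV_imp_deriv\<close>)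
qed

text \<open>The circle mean bounds \<open>F\<close> at radius \<open>x\<close> by a multiple of
  \<open>1 / sqrt (r - x)\<close>, which is integrable up to \<open>r\<close>. Integrating from the
  zero outwards shows that a zero near the circle together with a value of modulus near 1 forces a
  large mean of the derivative.\<close>

lemma growth_le_Dirichlet_integral:
  fixes f :: "complex \<Rightarrow> complex"
  assumes der: "\<And>z. z \<in> ball 0 1 \<Longrightarrow> (f has_field_derivative F z) (at z)"
    and al: "cmod \<alpha> = 1" and r: "0 \<le> \<rho>" "\<rho> < r" "r < 1"
    and zero: "f (of_real \<rho> * \<alpha>) = 0"
  shows "(cmod (f (of_real r * \<alpha>)))\<^sup>2 \<le> integral {0..2*pi} (\<lambda>x. (cmod (F (of_real r * cis x)))\<^sup>2) * (1 - \<rho>)"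
proof -
  define M where "M = integral {0..2*pi} (\<lambda>x. (cmod (F (of_real r * cis x)))\<^sup>2)"
  have holf: "f holomorphic_on ball 0 1"
    using der by (meson field_differentiable_at_within field_differentiable_def holomorphic_on_def)
  have holF: "F holomorphic_on ball 0 1"
    using der by (rule holomorphic_on_derivative[OF open_ball])
  have "0 \<le> 2 * pi * (r - cmod (of_real \<rho> * \<alpha>)) * (cmod (F (of_real \<rho> * \<alpha>)))\<^sup>2"
    using r al by (simp add: norm_mult)
  also have "\<dots> \<le> M"
    using norm_square_le_circle_mean[OF holF, of "of_real \<rho> * \<alpha>" r] al r by (simp add: norm_mult M_def)
  finally have M0: "M \<ge> 0" .
  have bound: "cmod (F (of_real x * \<alpha>)) \<le> sqrt (M / (2 * pi)) / sqrt (r - x)" if x: "\<rho> < x" "x < r" for x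
  proof -
    have "2 * pi * (r - x) * (cmod (F (of_real x * \<alpha>)))\<^sup>2 \<le> M"
      using norm_square_le_circle_mean[OF holF, of "of_real x * \<alpha>" r] al r x by (simp add: norm_mult M_def)
    then have "(cmod (F (of_real x * \<alpha>)))\<^sup>2 \<le> M / (2 * pi) / (r - x)"
      using x by (simp add: field_simps)
    then show ?thesis
      by (metis real_le_rsqrt real_sqrt_divide)
  qed
  \<comment> \<open>An antiderivative of the bound. The bound may be unbounded near
    \<open>x = r\<close>, but \<open>\<psi>\<close> is continuous there, and the derivatives are
    compared only on the open interval.\<close>
  define \<psi> where "\<psi> = (\<lambda>x. - 2 * sqrt (M / (2 * pi)) * sqrt (r - x))"
  have "norm (f (of_real r * \<alpha>) - f (of_real \<rho> * \<alpha>)) \<le> \<psi> r - \<psi> \<rho>"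
  proof (rule differentiable_bound_general[where f = "\<lambda>x. f (of_real x * \<alpha>)"])
    show "continuous_on {\<rho>..r} (\<lambda>x. f (of_real x * \<alpha>))"
      by (rule continuous_on_compose2[OF holomorphic_on_imp_continuous_on[OF holf]])
         (use r al in \<open>auto intro!: continuous_intros simp: norm_mult\<close>)
    show "continuous_on {\<rho>..r} \<psi>"
      unfolding \<psi>_def by (intro continuous_intros)
    fix x assume x: "\<rho> < x" "x < r"
    show "(\<psi> has_vector_derivative sqrt (M / (2 * pi)) / sqrt (r - x)) (at x)"
      unfolding \<psi>_def has_real_derivative_iff_has_vector_derivative[symmetric]
      using x by (auto intro!: derivative_eq_intros simp: divide_simps)
    have "((\<lambda>x. f (of_real x * \<alpha>)) has_vector_derivative (1 * \<alpha>) * F (of_real x * \<alpha>)) (at x)"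
      by (rule field_vector_diff_chain_at[unfolded o_def])
         (use x r al in \<open>auto intro!: der derivative_eq_intros simp: norm_mult\<close>)
    then show "((\<lambda>x. f (of_real x * \<alpha>)) has_vector_derivative \<alpha> * F (of_real x * \<alpha>)) (at x)"
      by simp
    show "norm (\<alpha> * F (of_real x * \<alpha>)) \<le> sqrt (M / (2 * pi)) / sqrt (r - x)"
      using bound[OF x] al by (simp add: norm_mult)
  qed (use r in auto)
  then have "cmod (f (of_real r * \<alpha>)) \<le> 2 * sqrt (M / (2 * pi)) * sqrt (r - \<rho>)"
    by (simp add: zero \<psi>_def)
  then have "(cmod (f (of_real r * \<alpha>)))\<^sup>2 \<le> (2 * sqrt (M / (2 * pi)) * sqrt (r - \<rho>))\<^sup>2"
    by (intro power_mono) auto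
  also have "\<dots> = 2 / pi * (M * (r - \<rho>))"
    using M0 r by (simp add: power_mult_distrib)
  also have "\<dots> \<le> 1 * (M * (1 - \<rho>))"
    using M0 r pi_gt3 by (intro mult_mono) auto
  finally show ?thesis by (simp add: M_def)
qed

section \<open>Blow-up at a boundary zero\<close>

lemma eval2_0 [simp]: "eval2 0 x y = 0"
  by (simp add: eval2_def)

lemma eval2_pCons [simp]: "eval2 (pCons a p) x y = poly a x + y * eval2 p x y"
  by (cases "pCons a p = 0") (auto simp: eval2_def map_poly_pCons)

lemma eval2_add [simp]: "eval2 (p + q) x y = eval2 p x y + eval2 q x y"
  by (induction p q rule: poly_induct2) (simp_all add: algebra_simps)

lemma eval2_smult [simp]: "eval2 (smult a p) x y = poly a x * eval2 p x y"
  by (induction p) (simp_all add: algebra_simps)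

text \<open>Chain rule: coefficients are polynomials in z1, so \<open>map_poly pderiv p\<close> is
  the partial derivative in z1 and \<open>pderiv p\<close> the one in z2. It serves both the partial
  derivatives and the restriction to a disc.\<close>

lemma eval2_has_field_derivative:
  assumes "(f has_field_derivative f') (at t within S)" "(g has_field_derivative g') (at t within S)"
  shows "((\<lambda>t. eval2 p (f t) (g t)) has_field_derivative
      f' * eval2 (map_poly pderiv p) (f t) (g t) + g' * eval2 (pderiv p) (f t) (g t)) (at t within S)"
proof (induction p)
  case (pCons a p)
  have "((\<lambda>t. poly a (f t)) has_field_derivative poly (pderiv a) (f t) * f') (at t within S)"
    by (rule DERIV_chain2[OF poly_DERIV assms(1)])
  from DERIV_add[OF this DERIV_mult[OF assms(2) pCons.IH]]
  show ?case
    by (simp add: map_poly_pCons pderiv_pCons algebra_simps)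
qed simp

text \<open>Moves a boundary zero to the origin while staying within polynomials; the witness
  follows the Horner recursion in z2.\<close>

lemma eval2_affine_subst:
  "\<exists>q. \<forall>x y. eval2 q x y = eval2 p (\<alpha> + \<beta> * x) (\<gamma> + \<delta> * y)"
proof (induction p)
  case 0
  show ?case by (rule exI[of _ 0]) simp
next
  case (pCons a p)
  then obtain q where "\<forall>x y. eval2 q x y = eval2 p (\<alpha> + \<beta> * x) (\<gamma> + \<delta> * y)" by blast
  then show ?case
    by (intro exI[of _ "[:pcompose a [:\<alpha>, \<beta>:]:] + smult [:\<gamma>:] q + pCons 0 (smult [:\<delta>:] q)"])
       (simp add: poly_pcompose algebra_simps)
qed

lemma eval2_altdef:
  "eval2 q x y = (\<Sum>(j, i)\<in>(SIGMA j:{..degree q}. {..degree (coeff q j)}). coeff (coeff q j) i * x ^ i * y ^ j)"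
proof -
  have "eval2 q x y = (\<Sum>j\<le>degree q. poly (coeff q j) x * y ^ j)"
  proof (induction q)
    case (pCons a q)
    then show ?case
      by (cases "q = 0") (simp_all add: sum.atMost_Suc_shift sum_distrib_left mult_ac del: sum.atMost_Suc)
  qed simp
  also have "\<dots> = (\<Sum>j\<le>degree q. \<Sum>i\<le>degree (coeff q j). coeff (coeff q j) i * x ^ i * y ^ j)"
    by (simp add: poly_altdef sum_distrib_right)
  also have "\<dots> = (\<Sum>(j, i)\<in>(SIGMA j:{..degree q}. {..degree (coeff q j)}). coeff (coeff q j) i * x ^ i * y ^ j)"
    by (rule sum.Sigma) auto
  finally show ?thesis .
qed

section \<open>Rescaled polynomials and their limits\<close>

text \<open>A convergent sequence together with its limit is compact, so joint continuity becomes
  uniform on the product with \<open>K\<close>.\<close>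

lemma uniform_limit_parameter:
  fixes \<Phi> :: "'a::heine_borel \<Rightarrow> 'b::metric_space \<Rightarrow> 'c::metric_space"
  assumes cont: "continuous_on UNIV (\<lambda>(v, u). \<Phi> v u)" and v: "v \<longlonglongrightarrow> w" and K: "compact K"
  shows "uniform_limit K (\<lambda>n. \<Phi> (v n)) (\<Phi> w) sequentially"
proof (rule uniform_limitI)
  fix e :: real assume "e > 0"
  have "compact (insert w (range v) \<times> K)"
    by (intro compact_Times compact_sequence_with_limit v K)
  then have "uniformly_continuous_on (insert w (range v) \<times> K) (\<lambda>(v, u). \<Phi> v u)"
    by (rule compact_uniformly_continuous[rotated]) (rule continuous_on_subset[OF cont], simp)
  then obtain d where d: "d > 0" "\<And>a b. a \<in> insert w (range v) \<times> K \<Longrightarrow> b \<in> insert w (range v) \<times> K \<Longrightarrow>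
      dist b a < d \<Longrightarrow> dist ((\<lambda>(v, u). \<Phi> v u) b) ((\<lambda>(v, u). \<Phi> v u) a) < e"
    using \<open>e > 0\<close> unfolding uniformly_continuous_on_def by meson
  have "\<forall>\<^sub>F n in sequentially. dist (v n) w < d"
    using v d(1) by (rule tendstoD)
  then show "\<forall>\<^sub>F n in sequentially. \<forall>x\<in>K. dist (\<Phi> (v n) x) (\<Phi> w x) < e"
  proof eventually_elim
    case (elim n)
    show ?case
    proof
      fix x assume "x \<in> K"
      then show "dist (\<Phi> (v n) x) (\<Phi> w x) < e"
        using d(2)[of "(w, x)" "(v n, x)"] elim by (simp add: dist_Pair_Pair)
    qed
  qed
qed

text \<open>The rescaled polynomial \<open>e\<^sup>-\<^sup>K q(ex, ey)\<close> for \<open>q = \<Sum> c\<^sub>i\<^sub>j x\<^sup>i y\<^sup>j\<close> of order at least \<open>K\<close> at the origin;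
  at \<open>e = 0\<close> it is the homogeneous part of \<open>q\<close> of degree \<open>K\<close>, because \<open>0 ^ 0 = 1\<close>.\<close>

definition blow_up :: "(nat \<times> nat) set \<Rightarrow> (nat \<times> nat \<Rightarrow> complex) \<Rightarrow> nat \<Rightarrow> complex \<Rightarrow> complex \<Rightarrow> complex \<Rightarrow> complex"
  where "blow_up B c K e x y = (\<Sum>(j, i)\<in>B. c (j, i) * e ^ (i + j - K) * x ^ i * y ^ j)"

text \<open>On a complex line only one variable remains, which makes the fundamental theorem of
  algebra and the finiteness of roots available.\<close>

lemma blow_up_affine_poly:
  "\<exists>P. \<forall>u. blow_up B c K e (a + b * u) (a' + b' * u) = poly P u"
  by (rule exI[of _ "\<Sum>(j, i)\<in>B. smult (c (j, i) * e ^ (i + j - K)) ([:a, b:] ^ i * [:a', b':] ^ j)"])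
     (simp add: blow_up_def poly_sum case_prod_unfold mult_ac)

text \<open>At \<open>e = 0\<close> only terms of degree exactly \<open>K\<close> survive. The
  hypothesis excludes lower degrees, for which truncated subtraction would also produce
  \<open>0 ^ 0 = 1\<close>.\<close>

lemma blow_up_homogeneous:
  assumes "\<And>i j. (j, i) \<in> B \<Longrightarrow> K \<le> i + j"
  shows "blow_up B c K 0 (u * x) (u * y) = u ^ K * blow_up B c K 0 x y"
  unfolding blow_up_def sum_distrib_left
proof (rule sum.cong[OF refl], clarify)
  fix j i assume "(j, i) \<in> B"
  then show "c (j, i) * 0 ^ (i + j - K) * (u * x) ^ i * (u * y) ^ j = u ^ K * (c (j, i) * 0 ^ (i + j - K) * x ^ i * y ^ j)"
    using assms[of j i] by (cases "i + j = K") (auto simp: power_mult_distrib power_add power_0_left mult_ac)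
qed

lemma blow_up_0_nonzero:
  assumes B: "finite B" and c: "(l, k) \<in> B" "c (l, k) \<noteq> 0" and K: "\<And>i j. (j, i) \<in> B \<Longrightarrow> K \<le> i + j" "k + l = K"
  shows "\<exists>y. blow_up B c K 0 1 y \<noteq> 0"
proof (rule ccontr)
  assume vanish: "\<not> ?thesis"
  define P where "P = (\<Sum>(j, i)\<in>B. monom (c (j, i) * 0 ^ (i + j - K)) j)"
  have "poly P y = 0" for y
    using vanish by (simp add: P_def blow_up_def poly_sum poly_monom case_prod_unfold)
  then have "P = 0"
    using poly_all_0_iff_0 by blast
  \<comment> \<open>Among the surviving terms, those of total degree \<open>K\<close>, the exponent
    \<open>l\<close> of \<open>y\<close> forces the exponent \<open>k\<close> of \<open>x\<close>,
    so nothing can cancel \<open>c (l, k)\<close>.\<close>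
  have "coeff P l = (\<Sum>z\<in>B. if z = (l, k) then c (l, k) else 0)"
    unfolding P_def coeff_sum
    by (intro sum.cong) (use K in \<open>force simp: power_0_left\<close>)+
  then have "coeff P l = c (l, k)"
    using B c by simp
  with \<open>P = 0\<close> c show False by simp
qed

text \<open>Hurwitz's theorem for restrictions to lines that may themselves move with
  \<open>n\<close>; \<open>nonconst\<close> is the nonconstancy of the limit that the theorem
  requires.\<close>

lemma blow_up_Hurwitz:
  assumes B: "finite B" and \<delta>: "\<delta> > 0"
    and lim: "e \<longlonglongrightarrow> 0" "a \<longlonglongrightarrow> a0" "b \<longlonglongrightarrow> b0" "a' \<longlonglongrightarrow> a0'" "b' \<longlonglongrightarrow> b0'"
    and nz: "\<And>n u. u \<in> ball u0 \<delta> \<Longrightarrow> blow_up B c K (e n) (a n + b n * u) (a' n + b' n * u) \<noteq> 0"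
    and nonconst: "blow_up B c K 0 (a0 + b0 * v) (a0' + b0' * v) \<noteq> blow_up B c K 0 (a0 + b0 * w) (a0' + b0' * w)"
  shows "blow_up B c K 0 (a0 + b0 * u0) (a0' + b0' * u0) \<noteq> 0"
proof -
  define g where "g = (\<lambda>u. blow_up B c K 0 (a0 + b0 * u) (a0' + b0' * u))"
  obtain P where P: "\<And>u. g u = poly P u"
    using blow_up_affine_poly[of B c K 0 a0 b0 a0' b0'] by (auto simp: g_def)
  have "g u0 \<noteq> 0"
  proof (rule Hurwitz_no_zeros[where g = g and ?z0.0 = u0 and S = "ball u0 \<delta>" and \<F> = "\<lambda>n u. blow_up B c K (e n) (a n + b n * u) (a' n + b' n * u)"])
    show "(\<lambda>u. blow_up B c K (e n) (a n + b n * u) (a' n + b' n * u)) holomorphic_on ball u0 \<delta>" for n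
      unfolding blow_up_def case_prod_unfold by (intro holomorphic_intros)
    show "g holomorphic_on ball u0 \<delta>"
      unfolding g_def blow_up_def case_prod_unfold by (intro holomorphic_intros)
    show "uniform_limit L (\<lambda>n u. blow_up B c K (e n) (a n + b n * u) (a' n + b' n * u)) g sequentially"
      if "compact L" for L
    proof -
      define \<Phi> where "\<Phi> = (\<lambda>(e, a, b, a', b') u. blow_up B c K e (a + b * u) (a' + b' * u))"
      have "continuous_on UNIV (\<lambda>(v, u). \<Phi> v u)"
        unfolding \<Phi>_def blow_up_def case_prod_unfold by (intro continuous_intros)
      moreover have "(\<lambda>n. (e n, a n, b n, a' n, b' n)) \<longlonglongrightarrow> (0, a0, b0, a0', b0')"
        by (intro tendsto_Pair lim)
      ultimately have "uniform_limit L (\<lambda>n. \<Phi> (e n, a n, b n, a' n, b' n)) (\<Phi> (0, a0, b0, a0', b0')) sequentially"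
        using that by (rule uniform_limit_parameter)
      then show ?thesis by (simp add: \<Phi>_def g_def)
    qed
    \<comment> \<open>A polynomial constant on a disc is constant everywhere, so the points
      \<open>v\<close> and \<open>w\<close> may lie outside the disc.\<close>
    show "\<not> g constant_on ball u0 \<delta>"
    proof
      assume "g constant_on ball u0 \<delta>"
      then obtain k where "\<And>u. u \<in> ball u0 \<delta> \<Longrightarrow> poly P u = k"
        unfolding constant_on_def P by blast
      then have "ball u0 \<delta> \<subseteq> {u. poly (P - [:k:]) u = 0}" by auto
      moreover have "infinite (ball u0 \<delta>)"
        using \<delta> finite_imp_not_open[of "ball u0 \<delta>"] by auto
      ultimately have "P - [:k:] = 0"
        using poly_roots_finite[of "P - [:k:]"] finite_subset by blast
      then have "g u = k" for u
        by (simp add: P)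
      with nonconst show False by (simp add: g_def)
    qed
  qed (use nz \<delta> in auto)
  then show ?thesis by (simp add: g_def)
qed

text \<open>In the coordinates \<open>z1 = \<mu>1 (1 + x)\<close>,
  \<open>z2 = \<mu>2 (1 + y)\<close>, rescaled by \<open>s\<close>, the disc with parameter
  \<open>s\<close> tends to the line \<open>y = \<i> + x\<close>. The form \<open>Q\<close> is
  nonconstant on this line because \<open>Q(1, 1)\<close> is nonzero, so it has a root there, and
  Hurwitz's theorem carries the root to small \<open>s\<close>.\<close>

lemma stable_zero_curve:
  fixes p :: bipoly and \<mu>1 \<mu>2 :: complex
  assumes nozero: "\<forall>z1 \<in> ball 0 1. \<forall>z2 \<in> ball 0 1. eval2 p z1 z2 \<noteq> 0"
    and mu: "cmod \<mu>1 = 1" "cmod \<mu>2 = 1" "eval2 p \<mu>1 \<mu>2 = 0"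
  shows "\<exists>C>0. \<exists>\<delta>>0. \<forall>s. 0 < s \<and> s < \<delta> \<longrightarrow>
    (\<exists>\<xi>. cmod \<xi> \<le> C \<and> eval2 p (\<mu>1 * (1 + of_real s * \<xi>)) (\<mu>2 * cis s * (1 + of_real s * \<xi>)) = 0)"
proof -
  obtain q where q: "\<And>x y. eval2 q x y = eval2 p (\<mu>1 + \<mu>1 * x) (\<mu>2 + \<mu>2 * y)"
    using eval2_affine_subst by metis
  define A where "A = (SIGMA j:{..degree q}. {..degree (coeff q j)})"
  define c where "c = (\<lambda>(j, i). coeff (coeff q j) i)"
  define B where "B = {z \<in> A. c z \<noteq> 0}"
  have finB: "finite B" by (simp add: B_def A_def)
  have q_sum: "eval2 q x y = (\<Sum>(j, i)\<in>B. c (j, i) * x ^ i * y ^ j)" for x y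
    unfolding eval2_altdef A_def[symmetric]
    by (rule sum.mono_neutral_cong_right) (auto simp: B_def c_def A_def)
  \<comment> \<open>The point \<open>(-1, -1)\<close> is the centre of the bidisc in the new
    coordinates, so \<open>q\<close> is not zero.\<close>
  have "eval2 q (-1) (-1) \<noteq> 0"
    using nozero by (simp add: q)
  then have "B \<noteq> {}" by (auto simp: q_sum)
  define K where "K = Min ((\<lambda>(j, i). i + j) ` B)"
  have K_le: "K \<le> i + j" if "(j, i) \<in> B" for i j
    unfolding K_def using finB that by (intro Min_le) force+
  have "K \<in> (\<lambda>(j, i). i + j) ` B"
    unfolding K_def using finB \<open>B \<noteq> {}\<close> by (intro Min_in) auto
  then obtain k l where kl: "(l, k) \<in> B" "k + l = K" by auto
  then have ckl: "c (l, k) \<noteq> 0" by (simp add: B_def)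
  let ?R = "blow_up B c K"
  have scale: "eval2 q (e * x) (e * y) = e ^ K * ?R e x y" for e x y
    unfolding q_sum blow_up_def sum_distrib_left
  proof (rule sum.cong[OF refl], clarify)
    fix j i assume "(j, i) \<in> B"
    then have "e ^ i * e ^ j = e ^ K * e ^ (i + j - K)"
      using K_le[of j i] by (simp add: power_add[symmetric])
    then show "c (j, i) * (e * x) ^ i * (e * y) ^ j = e ^ K * (c (j, i) * e ^ (i + j - K) * x ^ i * y ^ j)"
      by (simp add: power_mult_distrib algebra_simps)
  qed
  \<comment> \<open>\<open>1 + e x\<close> is the convex combination of 1 and \<open>x + 1\<close>
    with weights \<open>1 - e\<close> and \<open>e\<close>, hence lies in the open unit disc;
    likewise for \<open>y\<close>.\<close>
  have nz: "?R (of_real e) x y \<noteq> 0" if e: "0 < e" "e < 1" and xy: "cmod (x + 1) < 1/2" "cmod (y + 1) < 1/2" for e x y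
  proof -
    have "cmod (1 + of_real e * x) < 1" if "cmod (x + 1) < 1/2" for x
    proof -
      have "cmod (1 + of_real e * x) = cmod (of_real (1 - e) + of_real e * (x + 1))"
        by (simp add: algebra_simps)
      also have "\<dots> \<le> (1 - e) + e * cmod (x + 1)"
        using e norm_triangle_ineq[of "of_real (1 - e)" "of_real e * (x + 1)"]
        by (simp only: norm_mult norm_of_real)
      also have "\<dots> < (1 - e) + e * 1"
        using e that by (intro add_strict_left_mono mult_strict_left_mono) auto
      finally show ?thesis by simp
    qed
    then have "cmod (\<mu>1 * (1 + of_real e * x)) < 1" "cmod (\<mu>2 * (1 + of_real e * y)) < 1"
      using mu xy by (simp_all add: norm_mult)
    then have "eval2 q (of_real e * x) (of_real e * y) \<noteq> 0"
      using nozero by (simp add: q distrib_left)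
    then show ?thesis by (simp add: scale)
  qed
  obtain y0 where y0: "?R 0 1 y0 \<noteq> 0"
    using blow_up_0_nonzero[where B = B and c = c and K = K, OF finB kl(1) ckl K_le kl(2)] by blast
  \<comment> \<open>The line runs from \<open>(-1, -1)\<close> at \<open>u = 0\<close> to
    \<open>(1, y0)\<close> at \<open>u = 1\<close>. A zero at the first point would make the form
    nonconstant on the line, and Hurwitz's theorem then contradicts that zero.\<close>
  have "?R 0 (-1 + 2 * 0) (-1 + (y0 + 1) * 0) \<noteq> 0"
  proof
    assume 0: "?R 0 (-1 + 2 * 0) (-1 + (y0 + 1) * 0) = 0"
    \<comment> \<open>For \<open>cmod u < d\<close> both displacements \<open>2 * u\<close> and
      \<open>(y0 + 1) * u\<close> stay below 1/2, as \<open>nz\<close> requires.\<close>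
    define d where "d = 1 / (2 * (2 + cmod (y0 + 1)))"
    have d: "d > 0" by (simp add: d_def add_pos_nonneg)
    have dd: "d * (2 + cmod (y0 + 1)) = 1/2"
      using norm_ge_zero[of "y0 + 1"] by (simp add: d_def field_simps del: norm_ge_zero) 
    have "?R 0 (-1 + 2 * 0) (-1 + (y0 + 1) * 0) \<noteq> 0"
    proof (rule blow_up_Hurwitz[OF finB d])
      \<comment> \<open>The two successors keep the scale strictly below 1 already at
        \<open>n = 0\<close>.\<close>
      show "(\<lambda>n. complex_of_real (1 / real (Suc (Suc n)))) \<longlonglongrightarrow> 0"
        using tendsto_of_real[OF LIMSEQ_Suc[OF LIMSEQ_inverse_real_of_nat], where 'a = complex]
        by (simp add: inverse_eq_divide del: of_nat_Suc)
      show "(\<lambda>n. -1 :: complex) \<longlonglongrightarrow> -1" "(\<lambda>n. -1 :: complex) \<longlonglongrightarrow> -1"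
        "(\<lambda>n. 2 :: complex) \<longlonglongrightarrow> 2" "(\<lambda>n. y0 + 1) \<longlonglongrightarrow> y0 + 1" by simp_all
      show "?R 0 (-1 + 2 * 1) (-1 + (y0 + 1) * 1) \<noteq> ?R 0 (-1 + 2 * 0) (-1 + (y0 + 1) * 0)"
        using y0 0 by simp
      fix n and u :: complex assume "u \<in> ball 0 d"
      then have u: "cmod u < d" by simp
      have "2 * cmod u < 1/2"
        using u dd d mult_nonneg_nonneg[of d "cmod (y0 + 1)"] norm_ge_zero[of "y0 + 1"]
        unfolding distrib_left by linarith
      moreover have "cmod (y0 + 1) * cmod u \<le> cmod (y0 + 1) * d"
        using u by (intro mult_left_mono) auto
      then have "cmod ((y0 + 1) * u) < 1/2"
        using dd d unfolding norm_mult distrib_left mult.commute[of d] by linarith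
      ultimately show "?R (complex_of_real (1 / real (Suc (Suc n)))) (-1 + 2 * u) (-1 + (y0 + 1) * u) \<noteq> 0"
        by (intro nz) (simp_all add: norm_mult)
    qed
    with 0 show False by simp
  qed
  then have R11: "?R 0 1 1 \<noteq> 0"
    using blow_up_homogeneous[where B = B and c = c and K = K and u = "-1" and x = 1 and y = 1, OF K_le] by simp
  have K0: "K \<noteq> 0"
  proof
    assume "K = 0"
    then show False
      using scale[of 0 1 1] R11 mu by (simp add: q)
  qed
  \<comment> \<open>Homogeneity gives \<open>Q(1, 1 + \<i> / v) = Q(v, \<i> + v) / v ^ K\<close>.
    Were the numerator constant, letting \<open>v\<close> run through the positive integers would
    give \<open>Q(1, 1) = 0\<close>, since \<open>K\<close> is positive.\<close>
  have nonconst: "\<exists>v. ?R 0 (0 + 1 * v) (\<i> + 1 * v) \<noteq> ?R 0 0 \<i>"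
  proof (rule ccontr)
    assume "\<not> ?thesis"
    then have const: "?R 0 v (\<i> + v) = ?R 0 0 \<i>" for v by simp
    have "?R 0 1 (1 + \<i> * inverse (of_nat (Suc n))) = ?R 0 0 \<i> * inverse (of_nat (Suc n)) ^ K" for n
    proof -
      have "of_nat (Suc n) * (1 + \<i> * inverse (of_nat (Suc n))) = \<i> + of_nat (Suc n)"
        by (simp add: distrib_left del: of_nat_Suc)
      then have "?R 0 0 \<i> = ?R 0 (of_nat (Suc n) * 1) (of_nat (Suc n) * (1 + \<i> * inverse (of_nat (Suc n))))"
        using const[of "of_nat (Suc n)"] by (simp only: mult_1_right)
      also have "\<dots> = of_nat (Suc n) ^ K * ?R 0 1 (1 + \<i> * inverse (of_nat (Suc n)))"
        by (rule blow_up_homogeneous) (rule K_le)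
      finally show ?thesis by (simp add: field_simps del: of_nat_Suc)
    qed
    moreover have inv: "(\<lambda>n. inverse (of_nat (Suc n)) :: complex) \<longlonglongrightarrow> 0"
      using LIMSEQ_Suc[OF lim_inverse_n[where 'a = complex]] by simp
    moreover have "(\<lambda>n. ?R 0 0 \<i> * inverse (of_nat (Suc n)) ^ K) \<longlonglongrightarrow> ?R 0 0 \<i> * 0 ^ K"
      by (intro tendsto_intros inv)
    moreover have "(\<lambda>n. ?R 0 1 (1 + \<i> * inverse (of_nat (Suc n)))) \<longlonglongrightarrow> ?R 0 1 (1 + \<i> * 0)"
      unfolding blow_up_def case_prod_unfold by (intro tendsto_intros inv)
    ultimately have "?R 0 1 1 = 0"
      using K0 LIMSEQ_unique by fastforce
    with R11 show False by simp
  qed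
  obtain P where P: "\<And>u. ?R 0 (0 + 1 * u) (\<i> + 1 * u) = poly P u"
    using blow_up_affine_poly by metis
  have "\<not> constant (poly P)"
  proof -
    have "?R 0 0 \<i> = poly P 0" using P[of 0] by simp
    then show ?thesis
      using nonconst unfolding P constant_def by metis
  qed
  then obtain \<xi>0 where \<xi>0: "?R 0 (0 + 1 * \<xi>0) (\<i> + 1 * \<xi>0) = 0"
    using fundamental_theorem_of_algebra unfolding P by blast
  \<comment> \<open>The extra 1 is the radius of the disc around \<open>\<xi>0\<close> on which
    Hurwitz's theorem is applied.\<close>
  define C where "C = cmod \<xi>0 + 1"
  let ?root = "\<lambda>s. \<exists>\<xi>. cmod \<xi> \<le> C \<and> eval2 p (\<mu>1 * (1 + of_real s * \<xi>)) (\<mu>2 * cis s * (1 + of_real s * \<xi>)) = 0"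
  have "\<exists>\<delta>>0. \<forall>s. 0 < s \<and> s < \<delta> \<longrightarrow> ?root s"
  proof (rule ccontr)
    assume "\<not> ?thesis"
    then have "\<forall>n. \<exists>s. 0 < s \<and> s < inverse (real (Suc n)) \<and> \<not> ?root s"
      by (metis inverse_positive_iff_positive of_nat_0_less_iff zero_less_Suc)
    then obtain s where s: "\<And>n. 0 < s n" "\<And>n. s n < inverse (real (Suc n))" "\<And>n. \<not> ?root (s n)"
      by metis
    have s0: "s \<longlonglongrightarrow> 0"
      by (rule tendsto_sandwich[OF _ _ tendsto_const LIMSEQ_inverse_real_of_nat])
         (use s in \<open>auto intro!: always_eventually less_imp_le simp del: of_nat_Suc\<close>)
    have "?R 0 (0 + 1 * \<xi>0) (\<i> + 1 * \<xi>0) \<noteq> 0"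
    proof (rule blow_up_Hurwitz[OF finB zero_less_one])
      show "(\<lambda>n. complex_of_real (s n)) \<longlonglongrightarrow> 0"
        using tendsto_of_real[OF s0, where 'a = complex] by simp
      show "(\<lambda>n. 0 :: complex) \<longlonglongrightarrow> 0" "(\<lambda>n. 1 :: complex) \<longlonglongrightarrow> 1" by simp_all
      \<comment> \<open>The slope of \<open>cis\<close> at 0 is the derivative of
        \<open>exp (\<i> * z)\<close>, which produces the offset \<open>\<i>\<close> of the limiting
        line.\<close>
      have "((\<lambda>z. exp (\<i> * z)) has_field_derivative \<i>) (at 0)"
        by (auto intro!: derivative_eq_intros)
      then have lim: "((\<lambda>h. (exp (\<i> * h) - 1) / h) \<longlongrightarrow> \<i>) (at 0)"
        by (simp add: DERIV_def)
      have "filterlim (\<lambda>n. complex_of_real (s n)) (at 0) sequentially"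
        using tendsto_of_real[OF s0, where 'a = complex] s(1)
        by (auto simp: filterlim_at less_imp_neq[symmetric] intro!: always_eventually)
      from filterlim_compose[OF lim this]
      show "(\<lambda>n. (cis (s n) - 1) / of_real (s n)) \<longlonglongrightarrow> \<i>"
        by (simp add: cis_conv_exp)
      show "(\<lambda>n. cis (s n)) \<longlonglongrightarrow> 1"
        using tendsto_cis[OF s0] by simp
      show "?R 0 (0 + 1 * (SOME v. ?R 0 (0 + 1 * v) (\<i> + 1 * v) \<noteq> ?R 0 0 \<i>)) (\<i> + 1 * (SOME v. ?R 0 (0 + 1 * v) (\<i> + 1 * v) \<noteq> ?R 0 0 \<i>))
         \<noteq> ?R 0 (0 + 1 * 0) (\<i> + 1 * 0)"
        using someI_ex[OF nonconst] by simp
      fix n u assume u: "u \<in> ball \<xi>0 1"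
      have "cmod u \<le> C"
        using u norm_triangle_ineq2[of u \<xi>0] by (simp add: C_def dist_norm norm_minus_commute)
      then have "eval2 p (\<mu>1 * (1 + of_real (s n) * u)) (\<mu>2 * cis (s n) * (1 + of_real (s n) * u)) \<noteq> 0"
        using s(3) by blast
      also have "eval2 p (\<mu>1 * (1 + of_real (s n) * u)) (\<mu>2 * cis (s n) * (1 + of_real (s n) * u))
        = eval2 q (of_real (s n) * (0 + 1 * u)) (of_real (s n) * ((cis (s n) - 1) / of_real (s n) + cis (s n) * u))"
        using s(1)[of n] unfolding q by (intro arg_cong2[where f = "eval2 p"]) (simp_all add: field_simps)
      finally show "?R (of_real (s n)) (0 + 1 * u) ((cis (s n) - 1) / of_real (s n) + cis (s n) * u) \<noteq> 0"
        unfolding scale by simp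
    qed
    with \<xi>0 show False by simp
  qed
  moreover have "C > 0" by (simp add: C_def add_nonneg_pos)
  ultimately show ?thesis by blast
qed

section \<open>Derivatives of rational inner functions\<close>

lemma in_H2_circle_bound:
  assumes "in_H2 f"
  shows "\<exists>B<\<infinity>. \<forall>r\<in>{0<..<1}. (\<integral>\<^sup>+ x. indicator ({0..2*pi} \<times> {0..2*pi}) x *
            ennreal ((cmod (f (of_real r * cis (fst x)) (of_real r * cis (snd x))))\<^sup>2) \<partial>lborel) \<le> B"
proof -
  define I where "I = (\<lambda>r. \<integral>\<^sup>+ x. indicator ({0..2*pi} \<times> {0..2*pi}) x *
            ennreal ((cmod (f (of_real r * cis (fst x)) (of_real r * cis (snd x))))\<^sup>2) \<partial>lborel)"
  define S where "S = (SUP r \<in> {0<..<1}. ennreal (1 / (4 * pi\<^sup>2)) * I r)"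
  have "S < \<infinity>" using assms by (simp add: in_H2_def S_def I_def)
  have "I r \<le> ennreal (4 * pi\<^sup>2) * S" if "r \<in> {0<..<1}" for r
  proof -
    have "I r = ennreal (4 * pi\<^sup>2) * (ennreal (1 / (4 * pi\<^sup>2)) * I r)"
      by (simp add: mult.assoc[symmetric] ennreal_mult[symmetric])
    also have "\<dots> \<le> ennreal (4 * pi\<^sup>2) * S"
      unfolding S_def using that by (intro mult_left_mono SUP_upper) auto
    finally show ?thesis .
  qed
  moreover have "ennreal (4 * pi\<^sup>2) * S < \<infinity>"
    using \<open>S < \<infinity>\<close> by (simp add: ennreal_mult_less_top)
  ultimately show ?thesis unfolding I_def by blast
qed

lemma in_H2_continuous_on_torus:
  assumes "in_H2 f" "0 < r" "r < 1"
  shows "continuous_on UNIV (\<lambda>x. f (of_real r * cis (fst x)) (of_real r * cis (snd x)))"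
proof -
  have "continuous_on (ball 0 1 \<times> ball 0 1) (\<lambda>(z1, z2). f z1 z2)"
    using assms by (simp add: in_H2_def)
  moreover have "continuous_on UNIV (\<lambda>x. (of_real r * cis (fst x), of_real r * cis (snd x)))"
    by (intro continuous_intros)
  moreover have "range (\<lambda>x. (of_real r * cis (fst x), of_real r * cis (snd x))) \<subseteq> ball 0 1 \<times> ball 0 1"
    using assms by (auto simp: norm_mult)
  ultimately have "continuous_on UNIV (\<lambda>x. (\<lambda>(z1, z2). f z1 z2) (of_real r * cis (fst x), of_real r * cis (snd x)))"
    by (rule continuous_on_compose2)
  then show ?thesis by simp
qed

text \<open>Connects the gauge integrals of the growth estimate with the Lebesgue integrals in
  \<open>in_H2\<close>.\<close>

lemma nn_integral_Icc_continuous: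
  fixes f :: "real \<Rightarrow> real"
  assumes f: "continuous_on UNIV f" "\<And>x. 0 \<le> f x"
  shows "(\<integral>\<^sup>+x. indicator {a..b} x * ennreal (f x) \<partial>lborel) = ennreal (integral {a..b} f)"
proof -
  have [measurable]: "f \<in> borel_measurable borel"
    using f by (simp add: borel_measurable_continuous_onI)
  have "(f has_integral integral {a..b} f) {a..b}"
    by (intro integrable_integral integrable_continuous_interval continuous_on_subset[OF f(1)]) simp
  then have "((\<lambda>x. indicator {a..b} x * f x) has_integral integral {a..b} f) UNIV"
    by (subst (asm) has_integral_restrict_UNIV[symmetric]) (simp only: indicator_times_eq_if)
  then have "(\<integral>\<^sup>+x. ennreal (indicator {a..b} x * f x) \<partial>lborel) = ennreal (integral {a..b} f)"
    by (rule nn_integral_has_integral_lborel[rotated 2]) (use f in auto)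
  then show ?thesis
    by (simp add: ennreal_mult' ennreal_indicator f)
qed

text \<open>Non-emptiness of \<open>Z\<close> supplies a singularity; finiteness leaves only
  finitely many \<open>s\<close> whose disc meets \<open>Z\<close> on its boundary. The circle
  integrals at radius \<open>r k\<close> have integrals over \<open>s\<close> bounded in
  \<open>k\<close>, yet for every other small \<open>s\<close> they are eventually at least of order
  \<open>1 / s\<close>.\<close>

lemma derivatives_not_both_in_H2:
  fixes p pt :: bipoly and m n :: nat
  defines "Z \<equiv> {lam \<in> torus. eval2 p (fst lam) (snd lam) = 0 \<and> eval2 pt (fst lam) (snd lam) = 0}"
  assumes nozero: "\<forall>z1 \<in> ball 0 1. \<forall>z2 \<in> ball 0 1. eval2 p z1 z2 \<noteq> 0"
    and refl: "\<forall>z1 z2. z1 \<noteq> 0 \<longrightarrow> z2 \<noteq> 0 \<longrightarrow>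
       eval2 pt z1 z2 = z1 ^ m * z2 ^ n * cnj (eval2 p (1 / cnj z1) (1 / cnj z2))"
    and Z: "finite Z" "Z \<noteq> {}"
  shows "\<not> in_H2 (\<lambda>z1 z2. deriv (\<lambda>w. eval2 pt w z2 / eval2 p w z2) z1)
       \<or> \<not> in_H2 (\<lambda>z1 z2. deriv (\<lambda>w. eval2 pt z1 w / eval2 p z1 w) z2)"
proof (rule ccontr)
  define D1 where "D1 = (\<lambda>z1 z2. deriv (\<lambda>w. eval2 pt w z2 / eval2 p w z2) z1)"
  define D2 where "D2 = (\<lambda>z1 z2. deriv (\<lambda>w. eval2 pt z1 w / eval2 p z1 w) z2)"
  assume "\<not> ?thesis"
  then have H2: "in_H2 D1" "in_H2 D2" by (simp_all add: D1_def D2_def)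
  have unit_cnj: "1 / cnj z = z" if "cmod z = 1" for z
    using that by (metis complex_cnj_cnj divide_conv_cnj mult_1 norm_one complex_mod_cnj)
  have norm_pt: "cmod (eval2 pt z1 z2) = cmod (eval2 p z1 z2)" if "cmod z1 = 1" "cmod z2 = 1" for z1 z2
  proof -
    have "z1 \<noteq> 0" "z2 \<noteq> 0" using that by auto
    then show ?thesis
      using refl that by (simp add: unit_cnj norm_mult norm_power)
  qed
  obtain \<mu>1 \<mu>2 where mu: "(\<mu>1, \<mu>2) \<in> Z" using Z by auto
  then have mu': "cmod \<mu>1 = 1" "cmod \<mu>2 = 1" "eval2 p \<mu>1 \<mu>2 = 0"
    by (auto simp: Z_def torus_def)
  obtain a b where ab: "\<mu>1 = cis a" "\<mu>2 = cis b"
    using mu' by (metis complex_norm_eq_1_exp cis_conv_exp)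
  obtain C \<delta> where C: "C > 0" "\<delta> > 0"
    and curve: "\<And>s. 0 < s \<Longrightarrow> s < \<delta> \<Longrightarrow> \<exists>\<xi>. cmod \<xi> \<le> C \<and>
      eval2 p (\<mu>1 * (1 + of_real s * \<xi>)) (\<mu>2 * cis s * (1 + of_real s * \<xi>)) = 0"
    using stable_zero_curve[OF nozero mu'] by blast

  \<comment> \<open>Discs whose boundary meets a common zero\<close>
  define bad where "bad = {s \<in> {0<..<pi}. \<exists>t. cmod t = 1 \<and> (\<mu>1 * t, \<mu>2 * cis s * t) \<in> Z}"
  \<comment> \<open>The ratio of the coordinates of the common zero determines \<open>cis s\<close>,
    and \<open>arccos\<close> recovers \<open>s\<close> because it lies between 0 and
    \<open>pi\<close>.\<close>
  have "bad \<subseteq> (\<lambda>(z1, z2). arccos (Re (z2 * \<mu>1 / (\<mu>2 * z1)))) ` Z"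
  proof
    fix s assume "s \<in> bad"
    then obtain t where s: "0 < s" "s < pi" and t: "cmod t = 1" "(\<mu>1 * t, \<mu>2 * cis s * t) \<in> Z"
      by (auto simp: bad_def)
    have "\<mu>2 * cis s * t * \<mu>1 / (\<mu>2 * (\<mu>1 * t)) = cis s"
      using mu' t by (auto simp: field_simps)
    then have "arccos (Re (\<mu>2 * cis s * t * \<mu>1 / (\<mu>2 * (\<mu>1 * t)))) = s"
      using s by (simp add: arccos_cos)
    with t(2) show "s \<in> (\<lambda>(z1, z2). arccos (Re (z2 * \<mu>1 / (\<mu>2 * z1)))) ` Z"
      by (force simp: image_iff)
  qed
  then have "finite bad" using Z finite_surj by blast
  then have AE_good: "AE s in lborel. s \<notin> bad"
    by (intro AE_not_in) (simp add: finite_imp_null_set_lborel)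

  \<comment> \<open>Circle integrals and their integral over the discs\<close>
  define r where "r = (\<lambda>k. 1 - 1 / real (Suc (Suc k)))"
  have r: "0 < r k" "r k < 1" for k by (simp_all add: r_def field_simps)
  have r_lim: "r \<longlonglongrightarrow> 1"
    using tendsto_diff[OF tendsto_const LIMSEQ_Suc[OF LIMSEQ_inverse_real_of_nat], of 1]
    by (simp add: r_def[abs_def] inverse_eq_divide del: of_nat_Suc)
  \<comment> \<open>By \<open>(u + v)^2 <= 2 u^2 + 2 v^2\<close>, this dominates the squared
    derivative along a disc, where the two partial derivatives carry unimodular factors.\<close>
  define H where "H = (\<lambda>k x. 2 * (cmod (D1 (of_real (r k) * cis (fst x)) (of_real (r k) * cis (snd x))))\<^sup>2
      + 2 * (cmod (D2 (of_real (r k) * cis (fst x)) (of_real (r k) * cis (snd x))))\<^sup>2)"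
  have contH: "continuous_on UNIV (H k)" for k
    unfolding H_def by (intro continuous_intros in_H2_continuous_on_torus H2 r)
  have measH: "(\<lambda>x. ennreal (H k x)) \<in> borel_measurable borel" for k
    using contH by (intro measurable_compose[OF _ measurable_ennreal] borel_measurable_continuous_onI)
  \<comment> \<open>\<open>a\<close> and \<open>b + s\<close> are arguments of \<open>\<mu>1\<close>
    and \<open>\<mu>2 * cis s\<close>, so the integrand is \<open>H k\<close> along the circle
    belonging to the disc with parameter \<open>s\<close>.\<close>
  define J where "J = (\<lambda>k s. \<integral>\<^sup>+x. indicator {0..2*pi} x * ennreal (H k (x + a, x + b + s)) \<partial>lborel)"
  obtain M where M: "M < \<infinity>" "\<And>k. (\<integral>\<^sup>+x. indicator ({0..2*pi} \<times> {0..2*pi}) x * ennreal (H k x) \<partial>lborel) \<le> M"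
  proof -
    obtain M1 where M1: "M1 < \<infinity>" "\<forall>r\<in>{0<..<1}. (\<integral>\<^sup>+ x. indicator ({0..2*pi} \<times> {0..2*pi}) x *
            ennreal ((cmod (D1 (of_real r * cis (fst x)) (of_real r * cis (snd x))))\<^sup>2) \<partial>lborel) \<le> M1"
      using in_H2_circle_bound[OF H2(1)] by (elim exE conjE)
    obtain M2 where M2: "M2 < \<infinity>" "\<forall>r\<in>{0<..<1}. (\<integral>\<^sup>+ x. indicator ({0..2*pi} \<times> {0..2*pi}) x *
            ennreal ((cmod (D2 (of_real r * cis (fst x)) (of_real r * cis (snd x))))\<^sup>2) \<partial>lborel) \<le> M2"
      using in_H2_circle_bound[OF H2(2)] by (elim exE conjE)
    have "(\<integral>\<^sup>+x. indicator ({0..2*pi} \<times> {0..2*pi}) x * ennreal (H k x) \<partial>lborel) \<le> 2 * M1 + 2 * M2" for k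
    proof -
      have [measurable]:
        "(\<lambda>x. ennreal ((cmod (D1 (of_real (r k) * cis (fst x)) (of_real (r k) * cis (snd x))))\<^sup>2)) \<in> borel_measurable borel"
        "(\<lambda>x. ennreal ((cmod (D2 (of_real (r k) * cis (fst x)) (of_real (r k) * cis (snd x))))\<^sup>2)) \<in> borel_measurable borel"
        by (intro measurable_compose[OF _ measurable_ennreal] borel_measurable_continuous_onI continuous_intros
            in_H2_continuous_on_torus H2 r)+
      have [measurable]: "{0..2*pi} \<times> {0..2*pi} \<in> sets (borel :: (real \<times> real) measure)"
        by (intro borel_closed closed_Times) auto
      have "(\<integral>\<^sup>+x. indicator ({0..2*pi} \<times> {0..2*pi}) x * ennreal (H k x) \<partial>lborel) =
        (\<integral>\<^sup>+x. 2 * (indicator ({0..2*pi} \<times> {0..2*pi}) x * ennreal ((cmod (D1 (of_real (r k) * cis (fst x)) (of_real (r k) * cis (snd x))))\<^sup>2))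
        + 2 * (indicator ({0..2*pi} \<times> {0..2*pi}) x * ennreal ((cmod (D2 (of_real (r k) * cis (fst x)) (of_real (r k) * cis (snd x))))\<^sup>2)) \<partial>lborel)"
        by (intro nn_integral_cong) (simp add: H_def ennreal_plus ennreal_mult algebra_simps)
      also have "\<dots> = 2 * (\<integral>\<^sup>+x. indicator ({0..2*pi} \<times> {0..2*pi}) x * ennreal ((cmod (D1 (of_real (r k) * cis (fst x)) (of_real (r k) * cis (snd x))))\<^sup>2) \<partial>lborel)
        + 2 * (\<integral>\<^sup>+x. indicator ({0..2*pi} \<times> {0..2*pi}) x * ennreal ((cmod (D2 (of_real (r k) * cis (fst x)) (of_real (r k) * cis (snd x))))\<^sup>2) \<partial>lborel)"
        by (simp add: nn_integral_add nn_integral_cmult)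
      also have "\<dots> \<le> 2 * M1 + 2 * M2"
        using r[of k] by (intro add_mono mult_left_mono M1(2)[rule_format] M2(2)[rule_format]) auto
      finally show ?thesis .
    qed
    moreover have "2 * M1 + 2 * M2 < \<infinity>"
      using M1(1) M2(1) by (simp add: ennreal_mult_less_top)
    ultimately show ?thesis using that by blast
  qed
  have J_le: "(\<integral>\<^sup>+s. indicator {0..2*pi} s * J k s \<partial>lborel) \<le> M" for k
  proof -
    have "(\<integral>\<^sup>+s. indicator {0..2*pi} s * J k s \<partial>lborel)
        = (\<integral>\<^sup>+x. indicator ({0..2*pi} \<times> {0..2*pi}) x * ennreal (H k x) \<partial>lborel)"
      unfolding J_def
    proof (rule nn_integral_periodic_shear[OF measH])
      have "cis (x + 2 * pi) = cis x" for x
        by (simp add: cis_mult[symmetric])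
      then show "ennreal (H k (x + 2 * pi, y)) = ennreal (H k (x, y))" 
        "ennreal (H k (x, y + 2 * pi)) = ennreal (H k (x, y))" for x y
        by (simp_all add: H_def)
    qed simp
    with M show ?thesis by simp
  qed
  \<comment> \<open>The bound \<open>pi\<close> keeps \<open>s\<close> in the interval on which
    \<open>bad\<close> is defined and inside \<open>{0..2*pi}\<close>.\<close>
  define d where "d = min \<delta> pi"
  have d: "0 < d" "d \<le> \<delta>" "d \<le> pi" using C by (auto simp: d_def)

  \<comment> \<open>Lower bound on a single disc\<close>
  have J_ge: "\<forall>\<^sub>F k in sequentially. ennreal (1 / (2 * C) / s) \<le> J k s" if s: "0 < s" "s < d" "s \<notin> bad" for s
  proof -
    obtain \<xi> where \<xi>: "cmod \<xi> \<le> C" "eval2 p (\<mu>1 * (1 + of_real s * \<xi>)) (\<mu>2 * cis s * (1 + of_real s * \<xi>)) = 0"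
      using curve s d by fastforce
    define \<beta> where "\<beta> = 1 + of_real s * \<xi>"
    have p\<beta>: "eval2 p (\<mu>1 * \<beta>) (\<mu>2 * cis s * \<beta>) = 0"
      using \<xi> by (simp add: \<beta>_def)
    \<comment> \<open>On the torus \<open>p\<close> and \<open>pt\<close> have equal modulus, so a
      zero of \<open>p\<close> there is a common zero, which \<open>s \<notin> bad\<close>
      excludes.\<close>
    have good: "eval2 p (\<mu>1 * t) (\<mu>2 * cis s * t) \<noteq> 0" if "cmod t = 1" for t
    proof
      assume 0: "eval2 p (\<mu>1 * t) (\<mu>2 * cis s * t) = 0"
      moreover have "eval2 pt (\<mu>1 * t) (\<mu>2 * cis s * t) = 0"
        using norm_pt[of "\<mu>1 * t" "\<mu>2 * cis s * t"] mu' that 0 by (simp add: norm_mult)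
      ultimately have "(\<mu>1 * t, \<mu>2 * cis s * t) \<in> Z"
        using mu' that by (simp add: Z_def torus_def norm_mult)
      then show False
        using s d that by (auto simp: bad_def)
    qed
    have inside: "eval2 p (\<mu>1 * t) (\<mu>2 * cis s * t) \<noteq> 0" if "cmod t < 1" for t
      using nozero mu' that by (simp add: norm_mult)
    have \<beta>1: "cmod \<beta> > 1"
      using good[of \<beta>] inside[of \<beta>] p\<beta> by (cases "cmod \<beta>" "1 :: real" rule: linorder_cases) auto
    have \<beta>0: "\<beta> \<noteq> 0" using \<beta>1 by auto
    \<comment> \<open>\<open>\<rho> * \<alpha>\<close> is \<open>1 / cnj \<beta>\<close>, the
      reflection of \<open>\<beta>\<close> in the unit circle; there the restricted function
      vanishes.\<close>
    define \<rho> where "\<rho> = 1 / cmod \<beta>"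
    define \<alpha> where "\<alpha> = \<beta> / of_real (cmod \<beta>)"
    have \<rho>: "0 < \<rho>" "\<rho> < 1" using \<beta>1 by (auto simp: \<rho>_def divide_less_eq)
    have \<alpha>: "cmod \<alpha> = 1" using \<beta>1 by (auto simp: \<alpha>_def norm_divide)
    have "1 - \<rho> = (cmod \<beta> - 1) / cmod \<beta>"
      using \<beta>0 by (simp add: \<rho>_def diff_divide_distrib)
    also have "\<dots> \<le> (cmod \<beta> - 1) / 1"
      using \<beta>1 by (intro frac_le) auto
    also have "\<dots> = cmod \<beta> - 1" by simp
    also have "\<dots> \<le> s * C"
    proof -
      have "cmod \<beta> \<le> 1 + s * cmod \<xi>"
        using norm_triangle_ineq[of 1 "of_real s * \<xi>"] s(1) by (simp add: \<beta>_def norm_mult)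
      moreover have "s * cmod \<xi> \<le> s * C"
        using \<xi>(1) s(1) by (intro mult_left_mono) auto
      ultimately show ?thesis by linarith
    qed
    finally have \<rho>_le: "1 - \<rho> \<le> s * C" .
    have inv: "1 / cnj (w * (of_real \<rho> * \<alpha>)) = w * \<beta>" if "cmod w = 1" for w
    proof -
      have "1 / cnj (w * (of_real \<rho> * \<alpha>)) = (1 / cnj w) * (1 / of_real \<rho>) * (1 / cnj \<alpha>)"
        by simp
      also have "\<dots> = w * (1 / of_real \<rho>) * \<alpha>"
        using that \<alpha> by (simp only: unit_cnj)
      also have "\<dots> = w * \<beta>"
        using \<beta>0 by (simp add: \<rho>_def \<alpha>_def)
      finally show ?thesis .
    qed
    have "1 / cnj (\<mu>1 * (of_real \<rho> * \<alpha>)) = \<mu>1 * \<beta>" "1 / cnj (\<mu>2 * cis s * (of_real \<rho> * \<alpha>)) = \<mu>2 * cis s * \<beta>"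
      by (rule inv, simp add: mu' norm_mult)+
    moreover have "\<mu>1 * (of_real \<rho> * \<alpha>) \<noteq> 0" "\<mu>2 * cis s * (of_real \<rho> * \<alpha>) \<noteq> 0"
      using mu' \<rho> \<alpha> by auto
    ultimately have pt0: "eval2 pt (\<mu>1 * (of_real \<rho> * \<alpha>)) (\<mu>2 * cis s * (of_real \<rho> * \<alpha>)) = 0"
      using refl p\<beta> by simp
    define f where "f = (\<lambda>t. eval2 pt (\<mu>1 * t) (\<mu>2 * cis s * t) / eval2 p (\<mu>1 * t) (\<mu>2 * cis s * t))"
    define F where "F = (\<lambda>t. \<mu>1 * D1 (\<mu>1 * t) (\<mu>2 * cis s * t) + \<mu>2 * cis s * D2 (\<mu>1 * t) (\<mu>2 * cis s * t))"
    have der: "(f has_field_derivative F t) (at t)" if "t \<in> ball 0 1" for t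
    proof -
      let ?z1 = "\<mu>1 * t" and ?z2 = "\<mu>2 * cis s * t"
      have p0: "eval2 p ?z1 ?z2 \<noteq> 0" using inside that by simp
      have "((\<lambda>w. eval2 pt w ?z2 / eval2 p w ?z2) has_field_derivative
        (eval2 (map_poly pderiv pt) ?z1 ?z2 * eval2 p ?z1 ?z2 - eval2 pt ?z1 ?z2 * eval2 (map_poly pderiv p) ?z1 ?z2)
          / (eval2 p ?z1 ?z2 * eval2 p ?z1 ?z2)) (at ?z1)"
        using p0 by (auto intro!: derivative_eq_intros eval2_has_field_derivative)
      then have D1: "D1 ?z1 ?z2 = (eval2 (map_poly pderiv pt) ?z1 ?z2 * eval2 p ?z1 ?z2 - eval2 pt ?z1 ?z2 * eval2 (map_poly pderiv p) ?z1 ?z2)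
          / (eval2 p ?z1 ?z2 * eval2 p ?z1 ?z2)"
        unfolding D1_def by (rule DERIV_imp_deriv)
      have "((\<lambda>w. eval2 pt ?z1 w / eval2 p ?z1 w) has_field_derivative
        (eval2 (pderiv pt) ?z1 ?z2 * eval2 p ?z1 ?z2 - eval2 pt ?z1 ?z2 * eval2 (pderiv p) ?z1 ?z2)
          / (eval2 p ?z1 ?z2 * eval2 p ?z1 ?z2)) (at ?z2)"
        using p0 by (auto intro!: derivative_eq_intros eval2_has_field_derivative)
      then have D2: "D2 ?z1 ?z2 = (eval2 (pderiv pt) ?z1 ?z2 * eval2 p ?z1 ?z2 - eval2 pt ?z1 ?z2 * eval2 (pderiv p) ?z1 ?z2)
          / (eval2 p ?z1 ?z2 * eval2 p ?z1 ?z2)"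
        unfolding D2_def by (rule DERIV_imp_deriv)
      have lin: "((*) w has_field_derivative w) (at t)" for w
        using DERIV_cmult_Id by blast
      show ?thesis
        unfolding f_def F_def D1 D2
        by (rule DERIV_cong[OF DERIV_divide[OF eval2_has_field_derivative[OF lin lin] eval2_has_field_derivative[OF lin lin] p0]])
           (simp add: add_divide_distrib[symmetric] algebra_simps)
    qed
    have "F holomorphic_on ball 0 1"
      using der by (rule holomorphic_on_derivative[OF open_ball])
    then have contF: "continuous_on (ball 0 1) F"
      by (rule holomorphic_on_imp_continuous_on)
    have J_I: "ennreal (integral {0..2*pi} (\<lambda>x. (cmod (F (of_real (r k) * cis x)))\<^sup>2)) \<le> J k s" for k
    proof -
      have "continuous_on UNIV (\<lambda>x. F (of_real (r k) * cis x))"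
        by (rule continuous_on_compose2[OF contF]) (use r[of k] in \<open>auto intro!: continuous_intros simp: norm_mult\<close>)
      then have "continuous_on UNIV (\<lambda>x. (cmod (F (of_real (r k) * cis x)))\<^sup>2)"
        by (intro continuous_intros)
      then have "ennreal (integral {0..2*pi} (\<lambda>x. (cmod (F (of_real (r k) * cis x)))\<^sup>2))
        = (\<integral>\<^sup>+x. indicator {0..2*pi} x * ennreal ((cmod (F (of_real (r k) * cis x)))\<^sup>2) \<partial>lborel)"
        by (intro nn_integral_Icc_continuous[symmetric]) auto
      also have "\<dots> \<le> J k s"
        unfolding J_def
      proof (intro nn_integral_mono mult_left_mono ennreal_leI)
        fix x
        have eqs: "\<mu>1 * (of_real (r k) * cis x) = of_real (r k) * cis (x + a)"
          "\<mu>2 * cis s * (of_real (r k) * cis x) = of_real (r k) * cis (x + b + s)"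
          by (simp_all add: ab cis_mult[symmetric])
        have "cmod (F (of_real (r k) * cis x)) \<le> cmod (D1 (of_real (r k) * cis (x + a)) (of_real (r k) * cis (x + b + s)))
           + cmod (D2 (of_real (r k) * cis (x + a)) (of_real (r k) * cis (x + b + s)))" (is "_ \<le> ?u + ?v")
          unfolding F_def eqs by (intro norm_triangle_le) (simp add: norm_mult mu')
        then have "(cmod (F (of_real (r k) * cis x)))\<^sup>2 \<le> (?u + ?v)\<^sup>2"
          by (intro power_mono) auto
        also have "\<dots> \<le> 2 * ?u\<^sup>2 + 2 * ?v\<^sup>2"
          using sum_squares_bound[of ?u ?v] by (simp add: power2_sum)
        finally show "(cmod (F (of_real (r k) * cis x)))\<^sup>2 \<le> H k (x + a, x + b + s)"
          by (simp add: H_def)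
      qed simp
      finally show ?thesis .
    qed
    \<comment> \<open>As \<open>p\<close> has no zero at the boundary point given by
      \<open>\<alpha>\<close>, \<open>f\<close> is continuous there with modulus 1, so its values at
      radius \<open>r k\<close> are eventually large enough for the growth estimate.\<close>
    have "isCont (\<lambda>t. eval2 q (\<mu>1 * t) (\<mu>2 * cis s * t)) \<alpha>" for q
      by (rule DERIV_isCont[OF eval2_has_field_derivative]) (rule DERIV_cmult_Id)+
    then have "isCont f \<alpha>"
      unfolding f_def using good[OF \<alpha>] by (intro isCont_divide) auto
    moreover have "(\<lambda>k. of_real (r k) * \<alpha>) \<longlonglongrightarrow> of_real 1 * \<alpha>"
      by (intro tendsto_intros r_lim)
    ultimately have "(\<lambda>k. f (of_real (r k) * \<alpha>)) \<longlonglongrightarrow> f \<alpha>"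
      using isCont_tendsto_compose by force
    then have "(\<lambda>k. (cmod (f (of_real (r k) * \<alpha>)))\<^sup>2) \<longlonglongrightarrow> (cmod (f \<alpha>))\<^sup>2"
      by (intro tendsto_intros)
    moreover have "cmod (f \<alpha>) = 1"
      using norm_pt[of "\<mu>1 * \<alpha>" "\<mu>2 * cis s * \<alpha>"] mu' \<alpha> good[OF \<alpha>] by (simp add: f_def norm_mult norm_divide)
    ultimately have "\<forall>\<^sub>F k in sequentially. (cmod (f (of_real (r k) * \<alpha>)))\<^sup>2 > 1 / 2"
      by (intro order_tendstoD(1)) auto
    moreover have "\<forall>\<^sub>F k in sequentially. r k > \<rho>"
      using r_lim \<rho> by (intro order_tendstoD(1)) auto
    ultimately show ?thesis
    proof eventually_elim
      case (elim k)
      let ?I = "integral {0..2*pi} (\<lambda>x. (cmod (F (of_real (r k) * cis x)))\<^sup>2)"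
      have "1 / 2 < ?I * (1 - \<rho>)"
        using elim growth_le_Dirichlet_integral[OF der \<alpha>, of \<rho> "r k"] \<rho> r[of k] pt0 by (simp add: f_def)
      also have "\<dots> \<le> ?I * (s * C)"
      proof (rule mult_left_mono[OF \<rho>_le])
        \<comment> \<open>Since \<open>1 - \<rho>\<close> is positive, the lower bound just obtained
          forces a positive integral.\<close>
        show "?I \<ge> 0"
          using calculation \<rho> by (smt (verit) mult_nonpos_nonneg divide_pos_pos)
      qed
      finally have "1 / (2 * C) / s \<le> ?I"
        using C s by (simp add: field_simps)
      then show ?case
        using J_I[of k] order_trans ennreal_leI by blast
    qed
  qed

  \<comment> \<open>Passage to the limit in the radius\<close>
  have "(\<integral>\<^sup>+s. indicator {0<..<d} s * ennreal (1 / (2 * C) / s) \<partial>lborel)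
      \<le> (\<integral>\<^sup>+s. liminf (\<lambda>k. indicator {0..2*pi} s * J k s) \<partial>lborel)"
  proof (rule nn_integral_mono_AE, use AE_good in eventually_elim)
    fix s assume "s \<notin> bad"
    show "indicator {0<..<d} s * ennreal (1 / (2 * C) / s) \<le> liminf (\<lambda>k. indicator {0..2*pi} s * J k s)"
    proof (cases "s \<in> {0<..<d}")
      case True
      then show ?thesis
        using J_ge[of s] \<open>s \<notin> bad\<close> d by (auto intro!: Liminf_bounded simp: indicator_def)
    qed simp
  qed
  \<comment> \<open>Fatou's lemma: the lower bounds hold only eventually in \<open>k\<close>, from
    an index depending on \<open>s\<close>.\<close>
  also have "\<dots> \<le> liminf (\<lambda>k. \<integral>\<^sup>+s. indicator {0..2*pi} s * J k s \<partial>lborel)"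
  proof (rule nn_integral_liminf)
    fix k
    have [measurable]: "(\<lambda>x. ennreal (H k x)) \<in> borel_measurable (borel \<Otimes>\<^sub>M borel)"
      using measH by (simp add: borel_prod)
    show "(\<lambda>s. indicator {0..2*pi} s * J k s) \<in> borel_measurable lborel"
      unfolding J_def by measurable
  qed
  also have "\<dots> \<le> M"
    using J_le by (intro order_trans[OF Liminf_le_Limsup Limsup_bounded]) auto
  finally show False
    using nn_integral_inverse_at_0[of d "1 / (2 * C)"] d C M by simp
qed

theorem theorem6p2:
  fixes p pt :: bipoly and m n :: nat
  assumes deg: "deg1 p = m" "deg2 p = n"
    and mn: "m * n \<ge> 1"
    and nozero: "\<forall>z1 \<in> ball 0 1. \<forall>z2 \<in> ball 0 1. eval2 p z1 z2 \<noteq> 0"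
    and refl: "\<forall>z1 z2. z1 \<noteq> 0 \<longrightarrow> z2 \<noteq> 0 \<longrightarrow>
       eval2 pt z1 z2 = z1 ^ m * z2 ^ n * cnj (eval2 p (1 / cnj z1) (1 / cnj z2))"
    and atoral: "\<forall>d. d dvd p \<and> d dvd pt \<longrightarrow> is_unit d"
    and N: "N_torus pt p = enat (2 * m * n)"
  shows "\<not> in_H2 (\<lambda>z1 z2. deriv (\<lambda>w. eval2 pt w z2 / eval2 p w z2) z1)
       \<or> \<not> in_H2 (\<lambda>z1 z2. deriv (\<lambda>w. eval2 pt z1 w / eval2 p z1 w) z2)"
proof -
  let ?Z = "{lam \<in> torus. eval2 p (fst lam) (snd lam) = 0 \<and> eval2 pt (fst lam) (snd lam) = 0}"
  have "N_torus pt p \<noteq> 0"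
    using N mn by (auto simp: zero_enat_def)
  \<comment> \<open>A sum over an infinite set is \<open>0\<close>, so the hypothesis on the multiplicities also gives finiteness.\<close>
  then have "finite ?Z" "?Z \<noteq> {}"
    unfolding N_torus_def using sum.infinite by force+
  then show ?thesis
    using nozero refl by (intro derivatives_not_both_in_H2)
qed

end
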